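(* Let $X=(X_1,\ldots,X_n)$ be an arbitrary finite sequence of random variables, each $X_i$ taking values in a measurable space $S$. Then $X$ can be represented as a mixture of elementary sequences. Formally, there exists a probability measure $\mu$ on $S^n$ (mixing measure), such that for any measurable $A\subseteq S^n$ $$\Pr(X\in A)=\int_{S^n}\Pr\big((\alpha\circ\beta_x)(x)\in A\big)\,d\mu(x)$$ holds, where $\alpha,\beta_x\in\Sigma_n$ are uniform random permutations, possibly not independent of each other, and $\beta_x$ is drawn independently for each $x\in S^n$. Furthermore, the claim remains true if the mixing measure $\mu$ is restricted to be order respecting for a total ordering $\prec$ on $S$. In that case, the representation is given by the formula $$\Pr(X\in A)=\int_{\mathrm{Ord}(S^n)}\Pr\big((\alpha\circ\beta_x)(x)\in A\big)\,d\mu(x).$$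
   Context: $[n]=\{1,\ldots,n\}$, and $\Sigma_n$ is the family of all permutations of $[n]$. For a permutation $\sigma\in\Sigma_n$ and a sequence $x=(x_1,\ldots,x_n)$, $\sigma(x)$ abbreviates $(x_{\sigma(1)},\ldots,x_{\sigma(n)})$. For two permutations $\alpha,\beta$, $\alpha\circ\beta$ denotes their composition, with the meaning $(\alpha\circ\beta)(x)=\alpha(\beta(x))$. A permutation $\sigma\in\Sigma_n$ is a uniform random permutation if it is chosen from the uniform distribution over $\Sigma_n$. Elementary sequence: let $x=(x_1,\ldots,x_n)$ be a deterministic sequence, each $x_i$ taking values from a set $S$, and let $\alpha,\beta\in\Sigma_n$ be uniform random permutations, possibly not independent of each other. Then $(\alpha\circ\beta)(x)$ is called an elementary sequence. A mixture of random sequences is the random sequence obtained by selecting one among the component sequences via some probability distribution (the mixing measure) and then outputting the selected sequence in its entirety; equivalently, its distribution is a convex combination of the distributions of the component sequences. For a total ordering $\prec$ on $S$, the subset of $S^n$ containing all ordered $n$-entry sequences with respect to $\prec$ is called the ordered sub-domain of $S^n$: $$\mathrm{Ord}(S^n)=\{(x_1,\ldots,x_n)\;|\;x_i\in S\ (\forall i),\ x_1\prec\ldots\prec x_n\}.$$ A probability measure $\mu$ on $S^n$ is called order respecting (for the ordering $\prec$) if $\mu(A)=0$ holds for every measurable set $A\subseteq S^n$ whenever $A\cap\mathrm{Ord}(S^n)=\emptyset$. *)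

theory Defs
  imports "HOL-Probability.Probability" "HOL-Combinatorics.Permutations"
begin

definition perms :: "nat \<Rightarrow> (nat \<Rightarrow> nat) set"
  where "perms n = {\<sigma>. \<sigma> permutes {1..n}}"

text \<open>Sequences over \<open>S\<close> of length \<open>n\<close> are extensional functions on \<open>{1..n}\<close>, so that
  the measurable space of sequences is the library's finite product.\<close>

definition seq_space :: "nat \<Rightarrow> 'a measure \<Rightarrow> (nat \<Rightarrow> 'a) measure"
  where "seq_space n S = (\<Pi>\<^sub>M i\<in>{1..n}. S)"

definition perm_seq :: "nat \<Rightarrow> (nat \<Rightarrow> nat) \<Rightarrow> (nat \<Rightarrow> 'a) \<Rightarrow> (nat \<Rightarrow> 'a)"
  where "perm_seq n \<sigma> x = (\<lambda>i\<in>{1..n}. x (\<sigma> i))"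

text \<open>The composition of permutations is taken in the sense of their action on sequences: first
  \<open>\<beta>\<close> acts on \<open>x\<close>, then \<open>\<alpha>\<close> acts on the result.  As functions on indices the order is reversed,
  so this is not \<open>perm_seq n (\<alpha> \<circ> \<beta>) x\<close>.\<close>

definition comp_perm_seq :: "nat \<Rightarrow> (nat \<Rightarrow> nat) \<Rightarrow> (nat \<Rightarrow> nat) \<Rightarrow> (nat \<Rightarrow> 'a) \<Rightarrow> (nat \<Rightarrow> 'a)"
  where "comp_perm_seq n \<alpha> \<beta> x = perm_seq n \<alpha> (perm_seq n \<beta> x)"

definition uniform_random_perm :: "'p measure \<Rightarrow> nat \<Rightarrow> ('p \<Rightarrow> nat \<Rightarrow> nat) \<Rightarrow> bool"
  where "uniform_random_perm P n \<sigma> \<longleftrightarrow>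
    \<sigma> \<in> measurable P (count_space (perms n)) \<and>
    distr P (count_space (perms n)) \<sigma> = uniform_count_measure (perms n)"

definition elementary_sequence ::
    "'p measure \<Rightarrow> nat \<Rightarrow> 'a measure \<Rightarrow> ('p \<Rightarrow> nat \<Rightarrow> 'a) \<Rightarrow> bool"
  where "elementary_sequence P n S Y \<longleftrightarrow> prob_space P \<and>
    (\<exists>x\<in>space (seq_space n S). \<exists>\<alpha> \<beta>.
      uniform_random_perm P n \<alpha> \<and> uniform_random_perm P n \<beta> \<and>
      (\<forall>\<omega>\<in>space P. Y \<omega> = comp_perm_seq n (\<alpha> \<omega>) (\<beta> \<omega>) x))"

text \<open>One uniform random permutation \<open>\<alpha>\<close>, together with a uniform random permutation \<open>\<beta> x\<close> for
  each sequence \<open>x\<close>.  Each \<open>\<beta> x\<close> may depend on \<open>\<alpha>\<close>; it is drawn independently for each \<open>x\<close> in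
  the sense that, once the value \<open>a\<close> of \<open>\<alpha>\<close> is given, the \<open>\<beta> x\<close> are mutually independent.
  (Unconditional mutual independence of infinitely many \<open>\<beta> x\<close> would force all but
  countably many of them to be independent of \<open>\<alpha>\<close>.)\<close>

definition random_perm_family ::
    "'p measure \<Rightarrow> nat \<Rightarrow> 'a measure \<Rightarrow> ('p \<Rightarrow> nat \<Rightarrow> nat) \<Rightarrow> ((nat \<Rightarrow> 'a) \<Rightarrow> 'p \<Rightarrow> nat \<Rightarrow> nat) \<Rightarrow> bool"
  where "random_perm_family P n S \<alpha> \<beta> \<longleftrightarrow> prob_space P \<and>
    uniform_random_perm P n \<alpha> \<and>
    (\<forall>x\<in>space (seq_space n S). uniform_random_perm P n (\<beta> x)) \<and>
    (\<forall>a\<in>perms n. prob_space.indep_vars (uniform_measure P {\<omega>\<in>space P. \<alpha> \<omega> = a})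
      (\<lambda>_. count_space (perms n)) \<beta> (space (seq_space n S)))"

lemma random_perm_family_elementary:
  assumes "random_perm_family P n S \<alpha> \<beta>" and "x \<in> space (seq_space n S)"
  shows "elementary_sequence P n S (\<lambda>\<omega>. comp_perm_seq n (\<alpha> \<omega>) (\<beta> x \<omega>) x)"
  using assms unfolding random_perm_family_def elementary_sequence_def by blast

text \<open>The ordering is a reflexive total order, so sequences with repeated entries can be
  ordered.\<close>

definition ordered_subdomain :: "nat \<Rightarrow> 'a measure \<Rightarrow> 'a rel \<Rightarrow> (nat \<Rightarrow> 'a) set"
  where "ordered_subdomain n S r =
    {x \<in> space (seq_space n S). \<forall>i\<in>{1..<n}. (x i, x (Suc i)) \<in> r}"

definition order_respecting ::
    "nat \<Rightarrow> 'a measure \<Rightarrow> 'a rel \<Rightarrow> (nat \<Rightarrow> 'a) measure \<Rightarrow> bool"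
  where "order_respecting n S r \<mu> \<longleftrightarrow>
    (\<forall>A\<in>sets (seq_space n S). A \<inter> ordered_subdomain n S r = {} \<longrightarrow> emeasure \<mu> A = 0)"

text \<open>The order need not be measurable, so neither need the ordered sub-domain be.  Integrals
  over it are taken with respect to the trace measure, which agrees with
  \<^const>\<open>restrict_space\<close> on measurable sets but is also meaningful on other sets.\<close>

definition trace_measure :: "'a measure \<Rightarrow> 'a set \<Rightarrow> 'a measure"
  where "trace_measure M \<Omega> =
    measure_of (\<Omega> \<inter> space M) ((\<inter>) \<Omega> ` sets M) (outer_measure_of M)"

lemma trace_measure_eq_restrict_space:
  assumes "\<Omega> \<inter> space M \<in> sets M"
  shows "trace_measure M \<Omega> = restrict_space M \<Omega>"
  unfolding trace_measure_def restrict_space_def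
proof (rule measure_of_eq)
  show sub: "(\<inter>) \<Omega> ` sets M \<subseteq> Pow (\<Omega> \<inter> space M)"
    using sets.sets_into_space by blast
  fix A
  assume "A \<in> sigma_sets (\<Omega> \<inter> space M) ((\<inter>) \<Omega> ` sets M)"
  also have "\<dots> = sets (restrict_space M \<Omega>)"
    unfolding restrict_space_def using sub by (simp add: sets_measure_of)
  finally have "A \<in> sets M"
    using assms by (simp add: sets_restrict_space_iff)
  then show "outer_measure_of M A = emeasure M A"
    by simp
qed

end

theory Submission
  imports Defs
begin

text \<open>
  Let \<open>\<nu>\<close> be the law of the sequence \<open>X\<close>.  Two observations carry the proof.

  First, the two uniform permutations are no restriction.  If \<open>\<sigma>\<^sub>x\<close> has an arbitrary distribution and
  \<open>\<alpha>\<close> is uniform and independent of it, then the permutation \<open>\<beta>\<^sub>x\<close> with \<open>\<alpha> \<circ> \<beta>\<^sub>x = \<sigma>\<^sub>x\<close> is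
  uniform as well.  Hence every family of distributions \<open>q x\<close> on the permutations arises from a
  permitted pair \<open>\<alpha>\<close>, \<open>\<beta>\<close> (locale \<open>perm_kernel\<close>), and it remains to write \<open>\<nu>\<close> as the result of
  drawing \<open>x\<close> from a mixing measure \<open>\<mu>\<close> and permuting it according to \<open>q x\<close>.

  Second, such a pair \<open>\<mu>\<close>, \<open>q\<close> is a disintegration of \<open>\<nu>\<close> along the orbits of the symmetric group:
  \<open>\<mu>\<close> decides on the orbit and \<open>q\<close> on the arrangement.  Every orbit contains an ordered sequence, so
  all its mass may be moved to ordered representatives.  The order need not be measurable,
  however, and neither need the ordered sub-domain be.  It is replaced by a measurable envelope
  \<open>E\<close> with respect to the symmetrization \<open>L\<close> of \<open>\<nu>\<close>.  The set \<open>E\<close> still meets all orbits, and a measure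
  with an \<open>L\<close>-density supported in \<open>E\<close> is order respecting.  Explicit formulas for the density of \<open>\<mu>\<close>
  and for \<open>q\<close> in terms of a Radon-Nikodym density of \<open>\<nu>\<close> with respect to \<open>L\<close> are given at
  \<open>disintegration_over_transversal\<close>; in particular \<open>q\<close> is measurable, so the integrand of the
  mixture is.

  For an order respecting \<open>\<mu>\<close> the ordered sub-domain has full outer measure, so that integrals over
  it with respect to the trace measure agree with integrals over the whole space
  (\<open>distr_trace_measure\<close>).  The representation without an order follows by choosing any order.
\<close>

section \<open>The action of permutations on sequences\<close>

lemma finite_perms: "finite (perms n)"
  by (simp add: perms_def finite_permutations)

lemma id_in_perms: "id \<in> perms n"
  by (simp add: perms_def permutes_id)

lemma card_perms_pos: "card (perms n) > 0"
  using finite_perms id_in_perms card_gt_0_iff by blast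

lemma inv_in_perms: "\<sigma> \<in> perms n \<Longrightarrow> inv \<sigma> \<in> perms n"
  by (simp add: perms_def permutes_inv)

lemma comp_in_perms: "\<sigma> \<in> perms n \<Longrightarrow> \<tau> \<in> perms n \<Longrightarrow> \<sigma> \<circ> \<tau> \<in> perms n"
  by (simp add: perms_def permutes_compose)

lemma perms_inv_cancel:
  assumes "\<sigma> \<in> perms n"
  shows "inv \<sigma> \<circ> \<sigma> = id" "\<sigma> \<circ> inv \<sigma> = id" "inv (inv \<sigma>) = \<sigma>"
  using assms by (simp_all add: perms_def permutes_inv_o permutes_inv_inv)

lemma bij_betw_perms_comp:
  assumes "\<tau> \<in> perms n"
  shows "bij_betw (\<lambda>\<sigma>. \<sigma> \<circ> \<tau>) (perms n) (perms n)"
  and "bij_betw (\<lambda>\<sigma>. \<tau> \<circ> \<sigma>) (perms n) (perms n)"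
proof -
  show "bij_betw (\<lambda>\<sigma>. \<sigma> \<circ> \<tau>) (perms n) (perms n)"
    using assms by (intro bij_betwI[where g="\<lambda>\<sigma>. \<sigma> \<circ> inv \<tau>"])
      (auto simp: comp_in_perms inv_in_perms perms_inv_cancel comp_assoc)
  show "bij_betw (\<lambda>\<sigma>. \<tau> \<circ> \<sigma>) (perms n) (perms n)"
    using assms by (intro bij_betwI[where g="\<lambda>\<sigma>. inv \<tau> \<circ> \<sigma>"])
      (auto simp: comp_in_perms inv_in_perms perms_inv_cancel o_assoc)
qed

lemma bij_betw_perms_inv: "bij_betw inv (perms n) (perms n)"
  by (auto intro!: bij_betwI[where g=inv] simp: inv_in_perms perms_inv_cancel)

lemma sum_perms_comp_right: "\<tau> \<in> perms n \<Longrightarrow> (\<Sum>\<sigma>\<in>perms n. h (\<sigma> \<circ> \<tau>)) = (\<Sum>\<sigma>\<in>perms n. h \<sigma>)"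
  by (rule sum.reindex_bij_betw[OF bij_betw_perms_comp(1)])

lemma sum_perms_comp_left: "\<tau> \<in> perms n \<Longrightarrow> (\<Sum>\<sigma>\<in>perms n. h (\<tau> \<circ> \<sigma>)) = (\<Sum>\<sigma>\<in>perms n. h \<sigma>)"
  by (rule sum.reindex_bij_betw[OF bij_betw_perms_comp(2)])

lemma sum_perms_inv: "(\<Sum>\<sigma>\<in>perms n. h (inv \<sigma>)) = (\<Sum>\<sigma>\<in>perms n. h \<sigma>)"
  by (rule sum.reindex_bij_betw[OF bij_betw_perms_inv])

lemma perms_in_range: "\<sigma> \<in> perms n \<Longrightarrow> i \<in> {1..n} \<Longrightarrow> \<sigma> i \<in> {1..n}"
  unfolding perms_def by (simp only: mem_Collect_eq permutes_in_image)

text \<open>Sequences are functions of the index, so permutations act on them from the right: the inner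
  permutation of the action is the outer one of the composition of index maps.\<close>
lemma perm_seq_comp:
  assumes "\<sigma> \<in> perms n"
  shows "perm_seq n \<sigma> (perm_seq n \<tau> x) = perm_seq n (\<tau> \<circ> \<sigma>) x"
  using perms_in_range[OF assms] by (simp add: perm_seq_def fun_eq_iff)

lemma perm_seq_id: "x \<in> space (seq_space n S) \<Longrightarrow> perm_seq n id x = x"
  by (simp add: perm_seq_def seq_space_def space_PiM)

lemma measurable_perm_seq [measurable]:
  assumes "\<sigma> \<in> perms n"
  shows "perm_seq n \<sigma> \<in> measurable (seq_space n S) (seq_space n S)"
  unfolding perm_seq_def seq_space_def
  using assms by (intro measurable_restrict measurable_component_singleton) (rule perms_in_range)

lemma perm_seq_in_space:
  "\<sigma> \<in> perms n \<Longrightarrow> x \<in> space (seq_space n S) \<Longrightarrow> perm_seq n \<sigma> x \<in> space (seq_space n S)"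
  using measurable_space[OF measurable_perm_seq] .

lemma perm_seq_inv_cancel:
  assumes "\<sigma> \<in> perms n" "x \<in> space (seq_space n S)"
  shows "perm_seq n \<sigma> (perm_seq n (inv \<sigma>) x) = x" "perm_seq n (inv \<sigma>) (perm_seq n \<sigma> x) = x"
  using assms by (simp_all add: perm_seq_comp inv_in_perms perms_inv_cancel perm_seq_id)

section \<open>Sorting\<close>

text \<open>The order on \<open>S\<close> is a relation on a carrier set, and pulled back along a sequence \<open>x\<close> to
  indices it is only a total preorder, since entries may repeat.  Sorting is therefore needed for total
  transitive relations; the induction inserts the new element between the elements that are below
  it and the others.\<close>
lemma ex_sorted_wrt_list:
  assumes tot: "\<And>a b. a \<in> A \<Longrightarrow> b \<in> A \<Longrightarrow> R a b \<or> R b a"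
    and trans: "\<And>a b c. R a b \<Longrightarrow> R b c \<Longrightarrow> R a c"
  shows "set xs \<subseteq> A \<Longrightarrow> \<exists>ys. mset ys = mset xs \<and> sorted_wrt R ys"
proof (induction xs)
  case (Cons a xs)
  then obtain ys where ys: "mset ys = mset xs" "sorted_wrt R ys" by auto
  have A: "set ys \<subseteq> A" "a \<in> A"
    using Cons.prems mset_eq_setD[OF ys(1)] by auto
  let ?zs = "filter (\<lambda>y. R y a) ys @ a # filter (\<lambda>y. \<not> R y a) ys"
  have "R a z" if "z \<in> set ys" "\<not> R z a" for z
    using tot[of a z] that A by auto
  then have "sorted_wrt R ?zs"
    using ys(2) by (auto simp: sorted_wrt_append sorted_wrt_filter intro: trans)
  moreover have "mset ?zs = mset (a # xs)"
    using ys(1) by (simp flip: multiset_partition)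
  ultimately show ?case by blast
qed simp

text \<open>The indices are sorted, rather than the entries, so that the sorted list itself is the
  wanted permutation.\<close>
lemma ex_perm_ordered:
  assumes r: "linear_order_on (space S) r" and x: "x \<in> space (seq_space n S)"
  shows "\<exists>\<sigma>\<in>perms n. perm_seq n \<sigma> x \<in> ordered_subdomain n S r"
proof -
  have tot: "(a, b) \<in> r \<or> (b, a) \<in> r" if "a \<in> space S" "b \<in> space S" for a b
    using r that by (cases "a = b") (auto simp: order_on_defs refl_on_def total_on_def)
  have xS: "x i \<in> space S" if "i \<in> {1..n}" for i
    using x that by (auto simp: seq_space_def space_PiM)
  obtain ys where ys: "mset ys = mset [1..<Suc n]" "sorted_wrt (\<lambda>i j. (x i, x j) \<in> r) ys"
  proof -
    have "\<exists>ys. mset ys = mset [1..<Suc n] \<and> sorted_wrt (\<lambda>i j. (x i, x j) \<in> r) ys"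
    proof (rule ex_sorted_wrt_list)
      show "(x i, x k) \<in> r" if "(x i, x j) \<in> r" "(x j, x k) \<in> r" for i j k
        using r that by (auto simp: order_on_defs dest: transD)
      show "(x i, x j) \<in> r \<or> (x j, x i) \<in> r" if "i \<in> {1..n}" "j \<in> {1..n}" for i j
        using tot xS that by blast
    qed auto
    then show thesis using that by blast
  qed
  have set: "set ys = {1..n}" and len: "length ys = n" and dist: "distinct ys"
    using mset_eq_setD[OF ys(1)] mset_eq_length[OF ys(1)] mset_eq_imp_distinct_iff[OF ys(1)]
    by (simp_all add: atLeastLessThanSuc_atLeastAtMost del: upt_Suc mset_upt)
  \<comment> \<open>List positions start at 0 and sequence indices at 1.\<close>
  define \<sigma> where "\<sigma> = (\<lambda>i. if i \<in> {1..n} then ys ! (i - 1) else i)"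
  have "bij_betw (\<lambda>i. i - 1) {1..n} {..<n}"
    by (rule bij_betwI[where g=Suc]) auto
  then have "bij_betw ((!) ys \<circ> (\<lambda>i. i - 1)) {1..n} {1..n}"
    by (rule bij_betw_trans) (use bij_betw_nth[OF dist] len set in auto)
  then have "bij_betw \<sigma> {1..n} {1..n}"
    by (subst bij_betw_cong[where g="(!) ys \<circ> (\<lambda>i. i - 1)"]) (auto simp: \<sigma>_def)
  then have "\<sigma> permutes {1..n}"
    by (rule bij_imp_permutes) (auto simp: \<sigma>_def)
  then have \<sigma>: "\<sigma> \<in> perms n" by (simp add: perms_def)
  have "(x (\<sigma> i), x (\<sigma> (Suc i))) \<in> r" if "i \<in> {1..<n}" for i
    using sorted_wrt_nth_less[OF ys(2), of "i - 1" i] that by (auto simp: \<sigma>_def len)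
  then have "perm_seq n \<sigma> x \<in> ordered_subdomain n S r"
    using perm_seq_in_space[OF \<sigma> x] by (auto simp: ordered_subdomain_def perm_seq_def)
  with \<sigma> show ?thesis by blast
qed

section \<open>Envelopes and traces on nonmeasurable sets\<close>

lemma ex_measurable_envelope:
  assumes "finite_measure M" "\<Omega> \<subseteq> space M"
  shows "\<exists>E. measurable_envelope M \<Omega> E"
proof -
  interpret finite_measure M by fact
  obtain E where "E \<in> sets M" "\<Omega> \<subseteq> E" "outer_measure_of M \<Omega> = emeasure M E"
    using outer_measure_of_attain[OF assms(2)] by blast
  then have "measurable_envelope M \<Omega> E"
    using emeasure_finite[of E] by (simp add: measurable_envelope_eq2 less_top[symmetric])
  then show ?thesis ..
qed

text \<open>This links the notion of an order respecting measure to trace measures: it says that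
  the possibly nonmeasurable ordered sub-domain has full outer measure.\<close>
lemma order_respecting_iff_envelope:
  assumes "sets \<mu> = sets (seq_space n S)"
  shows "order_respecting n S r \<mu> \<longleftrightarrow> measurable_envelope \<mu> (ordered_subdomain n S r) (space \<mu>)"
proof -
  have \<Omega>: "ordered_subdomain n S r \<subseteq> space \<mu>"
    using sets_eq_imp_space_eq[OF assms] by (auto simp: ordered_subdomain_def)
  have "A \<inter> ordered_subdomain n S r = {} \<longleftrightarrow> A \<subseteq> space \<mu> - ordered_subdomain n S r"
    if "A \<in> sets (seq_space n S)" for A
    using sets.sets_into_space[OF that] unfolding sets_eq_imp_space_eq[OF assms] by blast
  then show ?thesis
    unfolding order_respecting_def measurable_envelope_eq1[OF \<Omega> sets.top] assms by simp
qed

text \<open>An envelope \<open>E\<close> of \<open>\<Omega>\<close> is a measurable stand-in for \<open>\<Omega>\<close>: no measurable subset of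
  \<open>E - \<Omega>\<close> has positive measure, so a density supported in \<open>E\<close> charges no measurable set that
  misses \<open>\<Omega>\<close>.\<close>
lemma density_restricts_envelope:
  assumes env: "measurable_envelope L \<Omega> E" and g: "g \<in> borel_measurable L" "\<And>x. x \<notin> E \<Longrightarrow> g x = 0"
  shows "measurable_envelope (density L g) \<Omega> (space (density L g))"
proof (subst measurable_envelope_eq1)
  show "\<Omega> \<subseteq> space (density L g)" using measurable_envelopeD(4)[OF env] by simp
  show "\<forall>F\<in>sets (density L g). F \<subseteq> space (density L g) - \<Omega> \<longrightarrow> emeasure (density L g) F = 0"
  proof (intro ballI impI)
    fix F assume "F \<in> sets (density L g)" and F: "F \<subseteq> space (density L g) - \<Omega>"
    then have FL: "F \<in> sets L" by simp
    have "emeasure L (F \<inter> E) = 0"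
      using measurable_envelopeD(2)[OF env] FL F by (intro measurable_envelopeD1[OF env]) auto
    then have "AE x in L. x \<notin> F \<inter> E"
      using measurable_envelopeD(2)[OF env] FL by (intro AE_not_in null_setsI) auto
    then have "(\<integral>\<^sup>+x. g x * indicator F x \<partial>L) = (\<integral>\<^sup>+x. 0 \<partial>L)"
      by (intro nn_integral_cong_AE, elim eventually_mono) (auto simp: g(2) split: split_indicator)
    then show "emeasure (density L g) F = 0"
      using g(1) FL by (simp add: emeasure_density)
  qed
qed simp

lemma sets_trace_measure:
  assumes "\<Omega> \<subseteq> space M"
  shows "sets (trace_measure M \<Omega>) = (\<inter>) \<Omega> ` sets M"
proof -
  have "sigma_algebra \<Omega> ((\<inter>) \<Omega> ` sets M)"
    using sets.sigma_algebra_axioms[of "restrict_space M \<Omega>"] assms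
    by (simp add: sets_restrict_space space_restrict_space2 space_restrict_space Int_absorb2)
  then show ?thesis
    using assms by (simp add: trace_measure_def Int_absorb2 sigma_algebra.sigma_sets_eq
      sets_measure_of sigma_algebra_iff2)
qed

lemma space_trace_measure: "\<Omega> \<subseteq> space M \<Longrightarrow> space (trace_measure M \<Omega>) = \<Omega>"
  by (simp add: trace_measure_def Int_absorb2 space_measure_of_conv)

text \<open>If every measurable set that misses \<open>\<Omega>\<close> is a null set, i.e. if the whole space is a
  measurable envelope of \<open>\<Omega>\<close>, then \<open>A\<close> and \<open>\<Omega> \<inter> A\<close> have the same (outer) measure.  Countable additivity
  on traces needs care because pairwise disjoint traces may come from overlapping measurable
  sets; but overlaps lie outside \<open>\<Omega>\<close>, so the measurable sets can be made disjoint without changing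
  their traces.\<close>
lemma emeasure_trace_measure:
  assumes env: "measurable_envelope M \<Omega> (space M)" and A: "A \<in> sets M"
  shows "emeasure (trace_measure M \<Omega>) (\<Omega> \<inter> A) = emeasure M A"
proof -
  have \<Omega>: "\<Omega> \<subseteq> space M"
    using env by (rule measurable_envelopeD)
  have outer: "outer_measure_of M (\<Omega> \<inter> B) = emeasure M B" if "B \<in> sets M" for B
    using measurable_envelopeD(3)[OF env that] that by (simp add: Int_commute Int_absorb2 sets.sets_into_space)
  have "countably_additive (sets (trace_measure M \<Omega>)) (outer_measure_of M)"
  proof (rule countably_additiveI)
    fix E :: "nat \<Rightarrow> 'a set"
    assume "range E \<subseteq> sets (trace_measure M \<Omega>)" and dis: "disjoint_family E"
    then have "\<forall>i. \<exists>B\<in>sets M. E i = \<Omega> \<inter> B"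
      unfolding sets_trace_measure[OF \<Omega>] by blast
    then obtain B where B: "\<And>i. B i \<in> sets M" "\<And>i. E i = \<Omega> \<inter> B i"
      by metis
    have D: "disjointed B i \<in> sets M" for i
      using sets.range_disjointed_sets[of B M] B(1) by blast
    have "\<Omega> \<inter> B i \<inter> B j = {}" if "i \<noteq> j" for i j
    proof -
      have "E i \<inter> E j = {}"
        using disjoint_family_onD[OF dis _ _ that] by simp
      then show ?thesis unfolding B(2) by auto
    qed
    then have "x \<notin> B j" if "x \<in> \<Omega>" "x \<in> B i" "j < i" for x i j
      using that by (metis IntI empty_iff less_irrefl)
    then have "\<Omega> \<inter> B i = \<Omega> \<inter> (B i - (\<Union>j\<in>{0..<i}. B j))" for i
      by auto
    then have E: "E i = \<Omega> \<inter> disjointed B i" for i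
      unfolding B(2) disjointed_def .
    have "(\<Sum>i. outer_measure_of M (E i)) = (\<Sum>i. emeasure M (disjointed B i))"
      by (simp add: E outer D)
    also have "\<dots> = emeasure M (\<Union>i. disjointed B i)"
      using D by (intro suminf_emeasure disjoint_family_disjointed) auto
    also have "\<dots> = outer_measure_of M (\<Omega> \<inter> (\<Union>i. disjointed B i))"
      using D by (intro outer[symmetric]) auto
    also have "\<Omega> \<inter> (\<Union>i. disjointed B i) = (\<Union>i. E i)"
      by (auto simp: E)
    finally show "(\<Sum>i. outer_measure_of M (E i)) = outer_measure_of M (\<Union>i. E i)" .
  qed
  moreover have "positive (sets (trace_measure M \<Omega>)) (outer_measure_of M)"
    by (simp add: positive_def)
  ultimately have "emeasure (trace_measure M \<Omega>) (\<Omega> \<inter> A) = outer_measure_of M (\<Omega> \<inter> A)"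
    using sets_trace_measure[OF \<Omega>] A
    by (intro emeasure_measure_of[OF trace_measure_def]) (auto dest: sets.sets_into_space)
  with outer[OF A] show ?thesis by simp
qed

text \<open>Consequently integrals over \<open>\<Omega>\<close> with respect to the trace measure are just integrals
  with respect to \<open>M\<close>, whether or not \<open>\<Omega>\<close> is measurable.\<close>
lemma distr_trace_measure:
  assumes env: "measurable_envelope M \<Omega> (space M)"
  shows "(\<lambda>x. x) \<in> measurable (trace_measure M \<Omega>) M"
    and "distr (trace_measure M \<Omega>) M (\<lambda>x. x) = M"
proof -
  have \<Omega>: "\<Omega> \<subseteq> space M"
    using env by (rule measurable_envelopeD)
  show meas: "(\<lambda>x. x) \<in> measurable (trace_measure M \<Omega>) M"
    using \<Omega> by (intro measurableI) (auto simp: space_trace_measure sets_trace_measure)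
  show "distr (trace_measure M \<Omega>) M (\<lambda>x. x) = M"
    using \<Omega> emeasure_trace_measure[OF env]
    by (intro measure_eqI) (auto simp: emeasure_distr[OF meas] space_trace_measure Int_commute)
qed

section \<open>Independence and conditioning in product spaces\<close>

lemma uniform_random_permI:
  assumes \<sigma>: "\<sigma> \<in> measurable P (count_space (perms n))"
    and eq: "\<And>b. b \<in> perms n \<Longrightarrow> emeasure P {\<omega> \<in> space P. \<sigma> \<omega> = b} = ennreal (1 / card (perms n))"
  shows "uniform_random_perm P n \<sigma>"
proof -
  have "emeasure (distr P (count_space (perms n)) \<sigma>) {b} = emeasure (uniform_count_measure (perms n)) {b}"
    if "b \<in> perms n" for b
  proof -
    have "\<sigma> -` {b} \<inter> space P = {\<omega> \<in> space P. \<sigma> \<omega> = b}" by auto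
    then show ?thesis
      using that eq[OF that] by (simp add: emeasure_distr[OF \<sigma>] emeasure_uniform_count_measure finite_perms)
  qed
  then show ?thesis
    unfolding uniform_random_perm_def using \<sigma> finite_perms
    by (auto intro!: measure_eqI_finite[where A="perms n"] simp: sets_uniform_count_measure)
qed

lemma indep_vars_PiM_coordinates:
  assumes Q: "\<And>i. i \<in> I \<Longrightarrow> prob_space (Q i)" and I: "I \<noteq> {}"
  shows "prob_space.indep_vars (PiM I Q) Q (\<lambda>i w. w i) I"
proof -
  interpret prob_space "PiM I Q" by (rule prob_space_PiM) (rule Q)
  have "distr (PiM I Q) (PiM I Q) (\<lambda>w. \<lambda>i\<in>I. w i) = distr (PiM I Q) (PiM I Q) (\<lambda>w. w)"
    by (rule distr_cong) (auto simp: space_PiM)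
  also have "\<dots> = PiM I (\<lambda>i. distr (PiM I Q) (Q i) (\<lambda>w. w i))"
    using Q by (auto simp: distr_PiM_component intro!: PiM_cong)
  finally show ?thesis
    using I by (subst indep_vars_iff_distr_eq_PiM') auto
qed

lemma indep_vars_distrI:
  assumes N: "prob_space N" and f: "f \<in> measurable N M" and I: "I \<noteq> {}"
    and X: "\<And>i. i \<in> I \<Longrightarrow> X i \<in> measurable M (M' i)"
    and indep: "prob_space.indep_vars N M' (\<lambda>i w. X i (f w)) I"
  shows "prob_space.indep_vars (distr N M f) M' X I"
proof -
  interpret N: prob_space N by fact
  interpret D: prob_space "distr N M f" by (rule N.prob_space_distr[OF f])
  have X': "(\<lambda>w. X i (f w)) \<in> measurable N (M' i)" if "i \<in> I" for i
    using measurable_compose[OF f X[OF that]] .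
  have "distr (distr N M f) (PiM I M') (\<lambda>x. \<lambda>i\<in>I. X i x) = distr N (PiM I M') (\<lambda>w. \<lambda>i\<in>I. X i (f w))"
    using X by (subst distr_distr[OF _ f]) (auto simp: comp_def intro!: measurable_restrict)
  also have "\<dots> = PiM I (\<lambda>i. distr N (M' i) (\<lambda>w. X i (f w)))"
    using indep X' by (subst (asm) N.indep_vars_iff_distr_eq_PiM'[OF I]) auto
  also have "\<dots> = PiM I (\<lambda>i. distr (distr N M f) (M' i) (X i))"
    using X by (intro PiM_cong) (auto simp: distr_distr[OF _ f] comp_def)
  finally show ?thesis
    using X by (subst D.indep_vars_iff_distr_eq_PiM'[OF I]) auto
qed

text \<open>In a product, conditioning the first factor on a value freezes it and leaves the second
  factor as it was.\<close>
lemma uniform_measure_pair_fst: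
  assumes N: "prob_space N" and Q: "prob_space Q" and a: "{a} \<in> sets N" "emeasure N {a} \<noteq> 0"
  shows "uniform_measure (N \<Otimes>\<^sub>M Q) {\<omega> \<in> space (N \<Otimes>\<^sub>M Q). fst \<omega> = a} = distr Q (N \<Otimes>\<^sub>M Q) (Pair a)"
proof -
  interpret N: prob_space N by fact
  interpret Q: prob_space Q by fact
  have aN: "a \<in> space N" using sets.sets_into_space[OF a(1)] by auto
  have slice: "{\<omega> \<in> space (N \<Otimes>\<^sub>M Q). fst \<omega> = a} = {a} \<times> space Q"
    using aN by (auto simp: space_pair_measure)
  show ?thesis
    unfolding slice
  proof (rule measure_eqI)
    fix A assume "A \<in> sets (uniform_measure (N \<Otimes>\<^sub>M Q) ({a} \<times> space Q))"
    then have A: "A \<in> sets (N \<Otimes>\<^sub>M Q)" by simp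
    have sec: "Pair a -` A \<in> sets Q" using A by (rule sets_Pair1)
    have eq: "{a} \<times> space Q \<inter> A = {a} \<times> (Pair a -` A)"
      using sets.sets_into_space[OF A] by (auto simp: space_pair_measure)
    show "emeasure (uniform_measure (N \<Otimes>\<^sub>M Q) ({a} \<times> space Q)) A = emeasure (distr Q (N \<Otimes>\<^sub>M Q) (Pair a)) A"
      using A a aN sec sets.sets_into_space[OF sec]
      by (simp add: eq Q.emeasure_pair_measure_Times emeasure_distr Q.emeasure_space_1
         Int_absorb2 ennreal_mult_divide_eq mult.commute[of "emeasure N {a}"])
  qed simp
qed

section \<open>Two uniform permutations with a prescribed product\<close>

text \<open>Let every sequence \<open>x\<close> come with a distribution \<open>q x\<close> on the permutations, according to
  which the entries of \<open>x\<close> are to be rearranged.  Any such \<open>q\<close> can be realised by a product of two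
  uniform permutations: draw \<open>\<alpha>\<close> uniformly and, independently, \<open>\<sigma>\<^sub>x\<close> from \<open>q x\<close> for each \<open>x\<close>, and
  put \<open>\<beta>\<^sub>x = \<sigma>\<^sub>x \<circ> \<alpha>\<^sup>-\<^sup>1\<close> as a function on indices.  Acting by \<open>\<beta>\<^sub>x\<close> and then by \<open>\<alpha>\<close> means acting by
  \<open>\<beta>\<^sub>x \<circ> \<alpha> = \<sigma>\<^sub>x\<close>, while \<open>\<beta>\<^sub>x\<close> is uniform because \<open>\<alpha>\<^sup>-\<^sup>1\<close> is uniform and independent of \<open>\<sigma>\<^sub>x\<close>.
  Given \<open>\<alpha> = a\<close>, the \<open>\<beta>\<^sub>x\<close> are functions of the independent \<open>\<sigma>\<^sub>x\<close>.  The sample points are the pairs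
  \<open>(\<alpha>, \<lambda>x. \<sigma>\<^sub>x)\<close>.\<close>
locale perm_kernel =
  fixes n :: nat and S :: "'a measure" and q :: "(nat \<Rightarrow> 'a) \<Rightarrow> (nat \<Rightarrow> nat) \<Rightarrow> real"
  assumes q_nonneg: "x \<in> space (seq_space n S) \<Longrightarrow> \<sigma> \<in> perms n \<Longrightarrow> 0 \<le> q x \<sigma>"
    and q_sum: "x \<in> space (seq_space n S) \<Longrightarrow> (\<Sum>\<sigma>\<in>perms n. q x \<sigma>) = 1"
    and inhabited: "space (seq_space n S) \<noteq> {}"
begin

definition kernel_measure :: "(nat \<Rightarrow> 'a) \<Rightarrow> (nat \<Rightarrow> nat) measure"
  where "kernel_measure x = point_measure (perms n) (\<lambda>\<sigma>. ennreal (q x \<sigma>))"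

definition kernel_product :: "((nat \<Rightarrow> 'a) \<Rightarrow> nat \<Rightarrow> nat) measure"
  where "kernel_product = (\<Pi>\<^sub>M x\<in>space (seq_space n S). kernel_measure x)"

definition coupling :: "((nat \<Rightarrow> nat) \<times> ((nat \<Rightarrow> 'a) \<Rightarrow> nat \<Rightarrow> nat)) measure"
  where "coupling = uniform_count_measure (perms n) \<Otimes>\<^sub>M kernel_product"

definition second_perm :: "(nat \<Rightarrow> 'a) \<Rightarrow> (nat \<Rightarrow> nat) \<times> ((nat \<Rightarrow> 'a) \<Rightarrow> nat \<Rightarrow> nat) \<Rightarrow> nat \<Rightarrow> nat"
  where "second_perm x \<omega> = snd \<omega> x \<circ> inv (fst \<omega>)"

lemma sets_kernel_measure [measurable_cong]: "sets (kernel_measure x) = sets (count_space (perms n))"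
  by (simp add: kernel_measure_def sets_point_measure)

lemma space_kernel_measure [simp]: "space (kernel_measure x) = perms n"
  by (simp add: kernel_measure_def space_point_measure)

lemma ennreal_sum_kernel:
  assumes "x \<in> space (seq_space n S)"
  shows "(\<Sum>\<sigma>\<in>perms n. ennreal (q x \<sigma>)) = 1"
  using assms by (subst sum_ennreal) (auto simp: q_sum q_nonneg)

lemma prob_space_kernel_measure:
  assumes "x \<in> space (seq_space n S)"
  shows "prob_space (kernel_measure x)"
proof
  show "emeasure (kernel_measure x) (space (kernel_measure x)) = 1"
    unfolding space_kernel_measure
    by (simp add: kernel_measure_def emeasure_point_measure_finite finite_perms ennreal_sum_kernel[OF assms])
qed

lemma prob_space_kernel_product: "prob_space kernel_product"
  unfolding kernel_product_def by (rule prob_space_PiM) (rule prob_space_kernel_measure)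

lemma prob_space_uniform: "prob_space (uniform_count_measure (perms n))"
  using finite_perms id_in_perms by (intro prob_space_uniform_count_measure) auto

lemma prob_space_coupling: "prob_space coupling"
  unfolding coupling_def by (rule prob_space_pair[OF prob_space_uniform prob_space_kernel_product])

lemma measurable_coordinate:
  assumes "x \<in> space (seq_space n S)"
  shows "(\<lambda>w. w x) \<in> measurable kernel_product (count_space (perms n))"
proof -
  have "(\<lambda>w. w x) \<in> measurable kernel_product (kernel_measure x)"
    unfolding kernel_product_def using assms by (rule measurable_component_singleton)
  then show ?thesis
    unfolding measurable_cong_sets[OF refl sets_kernel_measure] .
qed

lemma measurable_joint:
  assumes x: "x \<in> space (seq_space n S)"
  shows "(\<lambda>\<omega>. (fst \<omega>, snd \<omega> x)) \<in> measurable coupling (count_space (perms n \<times> perms n))"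
proof -
  have "fst \<in> measurable coupling (count_space (perms n))"
    unfolding coupling_def by (simp cong: measurable_cong_sets add: measurable_fst'' sets_uniform_count_measure_count_space[symmetric])
  moreover have "(\<lambda>\<omega>. snd \<omega> x) \<in> measurable coupling (count_space (perms n))"
    unfolding coupling_def by (rule measurable_compose[OF measurable_snd measurable_coordinate[OF x]])
  ultimately show ?thesis
    by (simp add: pair_measure_countable[symmetric] countable_finite finite_perms)
qed

text \<open>All distributions of interest are determined by the joint law of \<open>\<alpha>\<close> and a single \<open>\<sigma>\<^sub>x\<close>,
  which is the product of the uniform law and \<open>q x\<close>.\<close>
lemma emeasure_coupling:
  assumes x: "x \<in> space (seq_space n S)"
  shows "emeasure coupling {\<omega> \<in> space coupling. R (fst \<omega>) (snd \<omega> x)} =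
    (\<Sum>a\<in>perms n. \<Sum>\<sigma>\<in>perms n. ennreal (1 / card (perms n)) * (ennreal (q x \<sigma>) * of_bool (R a \<sigma>)))"
proof -
  interpret Q: prob_space kernel_product by (rule prob_space_kernel_product)
  have set: "{\<omega> \<in> space coupling. R (fst \<omega>) (snd \<omega> x)} \<in> sets coupling"
  proof -
    have "{\<omega> \<in> space coupling. R (fst \<omega>) (snd \<omega> x)} =
      (\<lambda>\<omega>. (fst \<omega>, snd \<omega> x)) -` {p \<in> perms n \<times> perms n. R (fst p) (snd p)} \<inter> space coupling"
      using measurable_space[OF measurable_joint[OF x]] by auto
    also have "\<dots> \<in> sets coupling"
      by (rule measurable_sets[OF measurable_joint[OF x]]) auto
    finally show ?thesis .
  qed
  have slice: "emeasure kernel_product (Pair a -` {\<omega> \<in> space coupling. R (fst \<omega>) (snd \<omega> x)})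
      = (\<Sum>\<sigma>\<in>perms n. ennreal (q x \<sigma>) * of_bool (R a \<sigma>))" if a: "a \<in> perms n" for a
  proof -
    have "Pair a -` {\<omega> \<in> space coupling. R (fst \<omega>) (snd \<omega> x)} = {w \<in> space kernel_product. R a (w x)}"
      using a by (auto simp: coupling_def space_pair_measure space_uniform_count_measure)
    also have "\<dots> = {w \<in> space kernel_product. w x \<in> {\<sigma> \<in> perms n. R a \<sigma>}}"
      using measurable_space[OF measurable_coordinate[OF x]] by auto
    also have "emeasure kernel_product \<dots> = emeasure (kernel_measure x) {\<sigma> \<in> perms n. R a \<sigma>}"
    proof -
      have "emeasure (distr kernel_product (kernel_measure x) (\<lambda>w. w x)) {\<sigma> \<in> perms n. R a \<sigma>} =
          emeasure kernel_product ((\<lambda>w. w x) -` {\<sigma> \<in> perms n. R a \<sigma>} \<inter> space kernel_product)"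
        unfolding kernel_product_def
        using x by (intro emeasure_distr measurable_component_singleton) (auto simp: sets_kernel_measure)
      moreover have "(\<lambda>w. w x) -` {\<sigma> \<in> perms n. R a \<sigma>} \<inter> space kernel_product =
          {w \<in> space kernel_product. w x \<in> {\<sigma> \<in> perms n. R a \<sigma>}}"
        by auto
      moreover have "distr kernel_product (kernel_measure x) (\<lambda>w. w x) = kernel_measure x"
        unfolding kernel_product_def using prob_space_kernel_measure x by (rule distr_PiM_component)
      ultimately show ?thesis by simp
    qed
    also have "\<dots> = (\<Sum>\<sigma>\<in>{\<sigma> \<in> perms n. R a \<sigma>}. ennreal (q x \<sigma>))"
      unfolding kernel_measure_def by (subst emeasure_point_measure_finite) (auto simp: finite_perms)
    also have "\<dots> = (\<Sum>\<sigma>\<in>perms n. ennreal (q x \<sigma>) * of_bool (R a \<sigma>))"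
      by (rule sum.mono_neutral_cong_left) (auto simp: finite_perms)
    finally show ?thesis .
  qed
  have "emeasure coupling {\<omega> \<in> space coupling. R (fst \<omega>) (snd \<omega> x)} =
    (\<integral>\<^sup>+a. emeasure kernel_product (Pair a -` {\<omega> \<in> space coupling. R (fst \<omega>) (snd \<omega> x)})
       \<partial>uniform_count_measure (perms n))"
    using Q.emeasure_pair_measure_alt[of "{\<omega> \<in> space coupling. R (fst \<omega>) (snd \<omega> x)}" "uniform_count_measure (perms n)"] set
    by (simp add: coupling_def)
  also have "\<dots> = (\<Sum>a\<in>perms n. ennreal (1 / card (perms n)) *
      emeasure kernel_product (Pair a -` {\<omega> \<in> space coupling. R (fst \<omega>) (snd \<omega> x)}))"
    unfolding uniform_count_measure_def by (rule nn_integral_point_measure_finite[OF finite_perms])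
  also have "\<dots> = (\<Sum>a\<in>perms n. \<Sum>\<sigma>\<in>perms n. ennreal (1 / card (perms n)) * (ennreal (q x \<sigma>) * of_bool (R a \<sigma>)))"
    by (intro sum.cong refl) (simp only: slice sum_distrib_left)
  finally show ?thesis .
qed

lemma measurable_second_perm:
  assumes x: "x \<in> space (seq_space n S)"
  shows "second_perm x \<in> measurable coupling (count_space (perms n))"
proof -
  have "(\<lambda>p. snd p \<circ> inv (fst p)) \<in> measurable (count_space (perms n \<times> perms n)) (count_space (perms n))"
    by (auto simp: comp_in_perms inv_in_perms)
  from measurable_compose[OF measurable_joint[OF x] this] show ?thesis
    by (simp add: second_perm_def[abs_def])
qed

lemma sum_const_perms: "(\<Sum>a\<in>perms n. ennreal (1 / card (perms n)) * c) = c"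
proof -
  have "(\<Sum>a\<in>perms n. ennreal (1 / card (perms n)) * c) = (\<Sum>a\<in>perms n. ennreal (1 / card (perms n))) * c"
    by (simp only: sum_distrib_right)
  also have "(\<Sum>a\<in>perms n. ennreal (1 / card (perms n))) = ennreal (\<Sum>a\<in>perms n. 1 / card (perms n))"
    by (rule sum_ennreal) simp
  also have "\<dots> = 1" using card_perms_pos[of n] by simp
  finally show ?thesis by simp
qed

lemma uniform_first_perm: "uniform_random_perm coupling n fst"
proof (rule uniform_random_permI)
  obtain x where x: "x \<in> space (seq_space n S)" using inhabited by blast
  have "fst \<in> measurable (count_space (perms n \<times> perms n)) (count_space (perms n))" by auto
  from measurable_compose[OF measurable_joint[OF x] this]
  show "fst \<in> measurable coupling (count_space (perms n))" by simp
  fix b assume b: "b \<in> perms n"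
  have "emeasure coupling {\<omega> \<in> space coupling. fst \<omega> = b} =
    (\<Sum>a\<in>perms n. \<Sum>\<sigma>\<in>perms n. ennreal (1 / card (perms n)) * (ennreal (q x \<sigma>) * of_bool (a = b)))"
    by (rule emeasure_coupling[OF x])
  also have "\<dots> = (\<Sum>a\<in>perms n. if b = a then ennreal (1 / card (perms n)) else 0)"
    using ennreal_sum_kernel[OF x] by (intro sum.cong refl) (auto simp flip: sum_distrib_left)
  also have "\<dots> = ennreal (1 / card (perms n))"
    using b by (simp add: finite_perms)
  finally show "emeasure coupling {\<omega> \<in> space coupling. fst \<omega> = b} = ennreal (1 / card (perms n))" .
qed

lemma uniform_second_perm:
  assumes x: "x \<in> space (seq_space n S)"
  shows "uniform_random_perm coupling n (second_perm x)"
proof (rule uniform_random_permI[OF measurable_second_perm[OF x]])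
  fix b assume b: "b \<in> perms n"
  have "emeasure coupling {\<omega> \<in> space coupling. second_perm x \<omega> = b} =
    (\<Sum>a\<in>perms n. \<Sum>\<sigma>\<in>perms n. ennreal (1 / card (perms n)) * (ennreal (q x \<sigma>) * of_bool (\<sigma> \<circ> inv a = b)))"
    unfolding second_perm_def by (rule emeasure_coupling[OF x])
  also have "\<dots> = (\<Sum>a\<in>perms n. ennreal (1 / card (perms n)) * ennreal (q x (b \<circ> a)))"
  proof (rule sum.cong[OF refl])
    fix a assume a: "a \<in> perms n"
    \<comment> \<open>Exactly one value of \<open>\<sigma>\<^sub>x\<close> gives \<open>\<beta>\<^sub>x = b\<close> once \<open>\<alpha> = a\<close>.\<close>
    have cancel: "\<sigma> \<circ> inv a = b \<longleftrightarrow> b \<circ> a = \<sigma>" for \<sigma>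
    proof
      assume "\<sigma> \<circ> inv a = b"
      then have "b \<circ> a = \<sigma> \<circ> (inv a \<circ> a)" by (metis comp_assoc)
      then show "b \<circ> a = \<sigma>" using perms_inv_cancel(1)[OF a] by simp
    next
      assume "b \<circ> a = \<sigma>"
      then have "\<sigma> \<circ> inv a = b \<circ> (a \<circ> inv a)" by (metis comp_assoc)
      then show "\<sigma> \<circ> inv a = b" using perms_inv_cancel(2)[OF a] by simp
    qed
    have "(\<Sum>\<sigma>\<in>perms n. ennreal (1 / card (perms n)) * (ennreal (q x \<sigma>) * of_bool (\<sigma> \<circ> inv a = b)))
      = (\<Sum>\<sigma>\<in>perms n. if b \<circ> a = \<sigma> then ennreal (1 / card (perms n)) * ennreal (q x \<sigma>) else 0)"
      unfolding cancel by (intro sum.cong) auto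
    then show "(\<Sum>\<sigma>\<in>perms n. ennreal (1 / card (perms n)) * (ennreal (q x \<sigma>) * of_bool (\<sigma> \<circ> inv a = b)))
      = ennreal (1 / card (perms n)) * ennreal (q x (b \<circ> a))"
      using a b by (simp add: finite_perms comp_in_perms)
  qed
  also have "\<dots> = ennreal (1 / card (perms n)) * (\<Sum>a\<in>perms n. ennreal (q x (b \<circ> a)))"
    by (simp add: sum_distrib_left)
  also have "(\<Sum>a\<in>perms n. ennreal (q x (b \<circ> a))) = 1"
    using sum_perms_comp_left[OF b, of "\<lambda>\<sigma>. ennreal (q x \<sigma>)"] ennreal_sum_kernel[OF x] by simp
  finally show "emeasure coupling {\<omega> \<in> space coupling. second_perm x \<omega> = b} = ennreal (1 / card (perms n))"
    by simp
qed

lemma random_perm_family_coupling: "random_perm_family coupling n S fst second_perm"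
  unfolding random_perm_family_def
proof (intro conjI ballI)
  fix a assume a: "a \<in> perms n"
  have "prob_space.indep_vars kernel_product kernel_measure (\<lambda>x w. w x) (space (seq_space n S))"
    unfolding kernel_product_def by (intro indep_vars_PiM_coordinates prob_space_kernel_measure inhabited)
  then have "prob_space.indep_vars kernel_product (\<lambda>_. count_space (perms n)) (\<lambda>x w. w x \<circ> inv a) (space (seq_space n S))"
  proof (rule prob_space.indep_vars_compose2[OF prob_space_kernel_product])
    show "(\<lambda>\<sigma>. \<sigma> \<circ> inv a) \<in> measurable (kernel_measure x) (count_space (perms n))" for x
      unfolding measurable_cong_sets[OF sets_kernel_measure refl]
      using a by (simp add: comp_in_perms inv_in_perms)
  qed
  then have "prob_space.indep_vars (distr kernel_product coupling (Pair a)) (\<lambda>_. count_space (perms n))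
    second_perm (space (seq_space n S))"
    using a by (intro indep_vars_distrI prob_space_kernel_product measurable_second_perm inhabited)
      (auto simp: second_perm_def coupling_def space_uniform_count_measure)
  moreover have "uniform_measure coupling {\<omega> \<in> space coupling. fst \<omega> = a} = distr kernel_product coupling (Pair a)"
    unfolding coupling_def using a card_perms_pos[of n]
    by (intro uniform_measure_pair_fst prob_space_uniform prob_space_kernel_product)
      (auto simp: sets_uniform_count_measure emeasure_uniform_count_measure finite_perms)
  ultimately show "prob_space.indep_vars (uniform_measure coupling {\<omega> \<in> space coupling. fst \<omega> = a})
    (\<lambda>_. count_space (perms n)) second_perm (space (seq_space n S))"
    by simp
qed (auto intro: prob_space_coupling uniform_first_perm uniform_second_perm)

lemma emeasure_coupling_comp_perm_seq:
  assumes x: "x \<in> space (seq_space n S)"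
  shows "emeasure coupling {\<omega> \<in> space coupling. comp_perm_seq n (fst \<omega>) (second_perm x \<omega>) x \<in> A} =
    (\<Sum>\<sigma>\<in>perms n. ennreal (q x \<sigma>) * indicator A (perm_seq n \<sigma> x))"
proof -
  have "emeasure coupling {\<omega> \<in> space coupling. comp_perm_seq n (fst \<omega>) (second_perm x \<omega>) x \<in> A} =
    emeasure coupling {\<omega> \<in> space coupling. perm_seq n (snd \<omega> x) x \<in> A}"
  proof (intro arg_cong[where f="emeasure coupling"] Collect_cong conj_cong refl)
    fix \<omega> assume "\<omega> \<in> space coupling"
    then have "fst \<omega> \<in> perms n"
      by (auto simp: coupling_def space_pair_measure space_uniform_count_measure)
    then show "comp_perm_seq n (fst \<omega>) (second_perm x \<omega>) x \<in> A \<longleftrightarrow> perm_seq n (snd \<omega> x) x \<in> A"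
      by (simp add: comp_perm_seq_def perm_seq_comp second_perm_def comp_assoc perms_inv_cancel)
  qed
  also have "\<dots> = (\<Sum>a\<in>perms n. \<Sum>\<sigma>\<in>perms n.
      ennreal (1 / card (perms n)) * (ennreal (q x \<sigma>) * of_bool (perm_seq n \<sigma> x \<in> A)))"
    by (rule emeasure_coupling[OF x])
  also have "\<dots> = (\<Sum>a\<in>perms n. ennreal (1 / card (perms n)) * (\<Sum>\<sigma>\<in>perms n. ennreal (q x \<sigma>) * indicator A (perm_seq n \<sigma> x)))"
    by (simp add: sum_distrib_left indicator_def)
  also have "\<dots> = (\<Sum>\<sigma>\<in>perms n. ennreal (q x \<sigma>) * indicator A (perm_seq n \<sigma> x))"
    by (rule sum_const_perms)
  finally show ?thesis .
qed

end

section \<open>Disintegration along orbits\<close>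

text \<open>The sum, over all permutations, of the images of \<open>\<nu>\<close>.  It is left unnormalised, so that it
  dominates \<open>\<nu>\<close>; its total mass is \<open>n!\<close> times that of \<open>\<nu>\<close>.\<close>
definition symmetrization :: "nat \<Rightarrow> 'a measure \<Rightarrow> (nat \<Rightarrow> 'a) measure \<Rightarrow> (nat \<Rightarrow> 'a) measure"
  where "symmetrization n S \<nu> =
    distr (count_space (perms n) \<Otimes>\<^sub>M \<nu>) (seq_space n S) (\<lambda>(\<sigma>, x). perm_seq n \<sigma> x)"

lemma sets_symmetrization [simp, measurable_cong]: "sets (symmetrization n S \<nu>) = sets (seq_space n S)"
  by (simp add: symmetrization_def)

lemma space_symmetrization [simp]: "space (symmetrization n S \<nu>) = space (seq_space n S)"
  by (simp add: symmetrization_def)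

lemma nn_integral_symmetrization:
  assumes \<nu>: "sigma_finite_measure \<nu>" "sets \<nu> = sets (seq_space n S)"
    and h: "h \<in> borel_measurable (seq_space n S)"
  shows "(\<integral>\<^sup>+x. h x \<partial>symmetrization n S \<nu>) = (\<Sum>\<sigma>\<in>perms n. \<integral>\<^sup>+x. h (perm_seq n \<sigma> x) \<partial>\<nu>)"
proof -
  interpret \<nu>: sigma_finite_measure \<nu> by fact
  have act: "(\<lambda>(\<sigma>, x). perm_seq n \<sigma> x) \<in> measurable (count_space (perms n) \<Otimes>\<^sub>M \<nu>) (seq_space n S)"
  proof (rule measurable_pair_measure_countable1)
    show "countable (perms n)" by (rule countable_finite[OF finite_perms])
    fix \<sigma> assume "\<sigma> \<in> perms n"
    then show "(\<lambda>x. case (\<sigma>, x) of (\<sigma>, x) \<Rightarrow> perm_seq n \<sigma> x) \<in> measurable \<nu> (seq_space n S)"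
      unfolding measurable_cong_sets[OF \<nu>(2) refl] by (simp add: measurable_perm_seq)
  qed
  have "(\<integral>\<^sup>+x. h x \<partial>symmetrization n S \<nu>) =
      (\<integral>\<^sup>+p. h (perm_seq n (fst p) (snd p)) \<partial>(count_space (perms n) \<Otimes>\<^sub>M \<nu>))"
    unfolding symmetrization_def using h act by (simp add: nn_integral_distr case_prod_beta)
  also have "\<dots> = (\<integral>\<^sup>+\<sigma>. \<integral>\<^sup>+x. h (perm_seq n \<sigma> x) \<partial>\<nu> \<partial>count_space (perms n))"
    using \<nu>.nn_integral_fst[OF measurable_compose[OF act h]] by (simp add: case_prod_beta)
  also have "\<dots> = (\<Sum>\<sigma>\<in>perms n. \<integral>\<^sup>+x. h (perm_seq n \<sigma> x) \<partial>\<nu>)"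
    by (rule nn_integral_count_space_finite[OF finite_perms])
  finally show ?thesis .
qed

text \<open>Permuting once more only reorders the sum; this invariance is what makes it possible to
  move mass within orbits by a change of variables.\<close>
lemma nn_integral_symmetrization_perm_seq:
  assumes \<nu>: "sigma_finite_measure \<nu>" "sets \<nu> = sets (seq_space n S)"
    and h: "h \<in> borel_measurable (seq_space n S)" and \<tau>: "\<tau> \<in> perms n"
  shows "(\<integral>\<^sup>+x. h (perm_seq n \<tau> x) \<partial>symmetrization n S \<nu>) = (\<integral>\<^sup>+x. h x \<partial>symmetrization n S \<nu>)"
  using sum_perms_comp_right[OF \<tau>, of "\<lambda>\<sigma>. \<integral>\<^sup>+x. h (perm_seq n \<sigma> x) \<partial>\<nu>"]
    measurable_compose[OF measurable_perm_seq[OF \<tau>] h] h \<nu>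
  by (simp add: nn_integral_symmetrization perm_seq_comp[OF \<tau>])

text \<open>The identity contributes \<open>\<nu>\<close> itself to the sum; hence \<open>\<nu>\<close> has a density.\<close>
lemma emeasure_le_symmetrization:
  assumes \<nu>: "sigma_finite_measure \<nu>" "sets \<nu> = sets (seq_space n S)" and A: "A \<in> sets (seq_space n S)"
  shows "emeasure \<nu> A \<le> emeasure (symmetrization n S \<nu>) A"
proof -
  have "emeasure \<nu> A = (\<integral>\<^sup>+x. indicator A x \<partial>\<nu>)"
    using A \<nu>(2) by simp
  also have "\<dots> = (\<integral>\<^sup>+x. indicator A (perm_seq n id x) \<partial>\<nu>)"
    using sets_eq_imp_space_eq[OF \<nu>(2)] by (intro nn_integral_cong) (simp add: perm_seq_id[of _ n S])
  also have "\<dots> \<le> (\<Sum>\<sigma>\<in>perms n. \<integral>\<^sup>+x. indicator A (perm_seq n \<sigma> x) \<partial>\<nu>)"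
    by (rule member_le_sum[OF id_in_perms _ finite_perms]) simp
  also have "\<dots> = emeasure (symmetrization n S \<nu>) A"
    using A nn_integral_symmetrization[OF \<nu>, of "indicator A"] by simp
  finally show ?thesis .
qed

lemma finite_measure_symmetrization:
  assumes \<nu>: "finite_measure \<nu>" "sets \<nu> = sets (seq_space n S)"
  shows "finite_measure (symmetrization n S \<nu>)"
proof
  interpret \<nu>: finite_measure \<nu> by fact
  have "emeasure (symmetrization n S \<nu>) (space (symmetrization n S \<nu>)) = (\<integral>\<^sup>+x. 1 \<partial>symmetrization n S \<nu>)"
    by simp
  also have "\<dots> = (\<Sum>\<sigma>\<in>perms n. emeasure \<nu> (space \<nu>))"
    by (subst nn_integral_symmetrization) (auto simp: \<nu> \<nu>.sigma_finite_measure_axioms)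
  finally show "emeasure (symmetrization n S \<nu>) (space (symmetrization n S \<nu>)) \<noteq> \<infinity>"
    using \<nu>.emeasure_finite by (simp add: ennreal_mult_eq_top_iff)
qed

text \<open>A measurable set \<open>E\<close> that meets every orbit can carry the mixing measure.  Let \<open>L\<close> be the
  symmetrization of \<open>\<nu>\<close>, \<open>f\<close> a density of \<open>\<nu>\<close> with respect to \<open>L\<close>, \<open>F(x)\<close> the sum of \<open>f\<close> over the
  rearrangements of \<open>x\<close>, and \<open>c(x)\<close> the number of permutations that bring \<open>x\<close> into \<open>E\<close>.  The mass
  \<open>F(x)\<close> of the orbit of \<open>x\<close> is divided equally among these \<open>c(x)\<close> permutations, which gives
  \<open>g = F / c\<close> on \<open>E\<close>; from each representative \<open>x\<close> in \<open>E\<close> it is redistributed over the orbit in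
  proportion to \<open>f\<close>, which gives \<open>q x \<sigma> = f(\<sigma>(x)) / F(x)\<close>.  The amount arriving at \<open>y\<close> is
  then \<open>\<Sum>\<^sub>\<sigma> f(y) / c(y) * 1\<^sub>E(\<sigma>\<^sup>-\<^sup>1(y)) = f(y)\<close>, because \<open>F\<close> and \<open>c\<close> are constant on orbits.
  Invariance of \<open>L\<close> turns this pointwise balance into an identity of measures.\<close>
lemma disintegration_over_transversal:
  assumes \<nu>: "finite_measure \<nu>" "sets \<nu> = sets (seq_space n S)"
    and E: "E \<in> sets (seq_space n S)"
    and meets: "\<And>x. x \<in> space (seq_space n S) \<Longrightarrow> \<exists>\<sigma>\<in>perms n. perm_seq n \<sigma> x \<in> E"
  obtains g :: "(nat \<Rightarrow> 'a) \<Rightarrow> ennreal" and q :: "(nat \<Rightarrow> 'a) \<Rightarrow> (nat \<Rightarrow> nat) \<Rightarrow> real"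
  where "g \<in> borel_measurable (seq_space n S)" "\<And>x. x \<notin> E \<Longrightarrow> g x = 0"
    "\<And>\<sigma>. \<sigma> \<in> perms n \<Longrightarrow> (\<lambda>x. q x \<sigma>) \<in> borel_measurable (seq_space n S)"
    "\<And>x \<sigma>. 0 \<le> q x \<sigma>" "\<And>x. (\<Sum>\<sigma>\<in>perms n. q x \<sigma>) = 1"
    "\<And>A. A \<in> sets (seq_space n S) \<Longrightarrow> emeasure \<nu> A =
      (\<integral>\<^sup>+x. (\<Sum>\<sigma>\<in>perms n. ennreal (q x \<sigma>) * indicator A (perm_seq n \<sigma> x))
        \<partial>density (symmetrization n S \<nu>) g)"
proof -
  define L where "L = symmetrization n S \<nu>"
  interpret \<nu>: finite_measure \<nu> by fact
  interpret L: finite_measure L unfolding L_def using \<nu> by (rule finite_measure_symmetrization)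
  have sf: "sigma_finite_measure \<nu>" by (rule \<nu>.sigma_finite_measure_axioms)
  have sets_L [simp, measurable_cong]: "sets L = sets (seq_space n S)"
    and space_L [simp]: "space L = space (seq_space n S)" by (simp_all add: L_def)
  have ac: "absolutely_continuous L \<nu>"
  proof (unfold absolutely_continuous_def, rule subsetI)
    fix A assume "A \<in> null_sets L"
    then show "A \<in> null_sets \<nu>"
      using emeasure_le_symmetrization[OF sf \<nu>(2), of A] \<nu>(2)
      by (intro null_setsI) (auto simp: null_sets_def L_def)
  qed
  obtain f where f: "f \<in> borel_measurable L" "AE x in L. RN_deriv L \<nu> x = ennreal (f x)" "\<And>x. 0 \<le> f x"
    using L.real_RN_deriv[OF \<nu>(1) ac] \<nu>(2) by (metis sets_L)
  have f_meas [measurable]: "f \<in> borel_measurable (seq_space n S)"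
    using f(1) by simp
  have "\<nu> = density L (RN_deriv L \<nu>)"
    using ac \<nu>(2) by (intro L.density_RN_deriv[symmetric]) auto
  also have "\<dots> = density L (\<lambda>x. ennreal (f x))"
    using f by (intro density_cong) auto
  finally have \<nu>_density: "\<nu> = density L (\<lambda>x. ennreal (f x))" .

  define F where "F x = (\<Sum>\<sigma>\<in>perms n. f (perm_seq n \<sigma> x))" for x
  define c where "c x = (\<Sum>\<sigma>\<in>perms n. indicator E (perm_seq n \<sigma> x) :: real)" for x
  define g where "g x = ennreal (F x / c x * indicator E x)" for x
  \<comment> \<open>An orbit with \<open>F = 0\<close> has no mass to distribute; the uniform law is a placeholder that
    keeps \<open>q x\<close> a probability.\<close>
  define q where "q x \<sigma> = (if F x = 0 then 1 / card (perms n) else f (perm_seq n \<sigma> x) / F x)" for x \<sigma>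

  have F_meas [measurable]: "F \<in> borel_measurable (seq_space n S)"
    unfolding F_def by measurable
  have c_meas [measurable]: "c \<in> borel_measurable (seq_space n S)"
    unfolding c_def using E by measurable
  have F_nonneg: "0 \<le> F x" for x unfolding F_def using f(3) by (intro sum_nonneg) auto
  have c_nonneg: "0 \<le> c x" for x unfolding c_def by (intro sum_nonneg) auto
  have F_inv: "F (perm_seq n \<tau> x) = F x" if "\<tau> \<in> perms n" for \<tau> x
    unfolding F_def using sum_perms_comp_left[OF that, of "\<lambda>\<sigma>. f (perm_seq n \<sigma> x)"]
    by (simp add: perm_seq_comp)
  have c_inv: "c (perm_seq n \<tau> x) = c x" if "\<tau> \<in> perms n" for \<tau> x
    unfolding c_def using sum_perms_comp_left[OF that, of "\<lambda>\<sigma>. indicator E (perm_seq n \<sigma> x) :: real"]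
    by (simp add: perm_seq_comp)
  have c_pos: "0 < c x" if x: "x \<in> space (seq_space n S)" for x
  proof -
    obtain \<sigma> where "\<sigma> \<in> perms n" "perm_seq n \<sigma> x \<in> E" using meets[OF x] by blast
    then show ?thesis
      unfolding c_def by (intro sum_pos2[OF finite_perms]) auto
  qed
  have g_meas: "g \<in> borel_measurable (seq_space n S)"
    unfolding g_def using E by measurable
  have q_meas: "(\<lambda>x. q x \<sigma>) \<in> borel_measurable (seq_space n S)" if "\<sigma> \<in> perms n" for \<sigma>
    using that unfolding q_def by measurable
  have q_nonneg: "0 \<le> q x \<sigma>" for x \<sigma>
    using f(3) F_nonneg by (simp add: q_def)
  have q_sum: "(\<Sum>\<sigma>\<in>perms n. q x \<sigma>) = 1" for x
    using card_perms_pos[of n] by (cases "F x = 0") (auto simp: q_def F_def simp flip: sum_divide_distrib)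

  have balance: "(\<Sum>\<sigma>\<in>perms n. g (perm_seq n (inv \<sigma>) y) * ennreal (q (perm_seq n (inv \<sigma>) y) \<sigma>)) = ennreal (f y)"
    if y: "y \<in> space (seq_space n S)" for y
  proof -
    have f_le_F: "f y \<le> F y"
      unfolding F_def using member_le_sum[of id "perms n" "\<lambda>\<sigma>. f (perm_seq n \<sigma> y)"] f(3) y
      by (simp add: id_in_perms finite_perms perm_seq_id)
    have summand: "g (perm_seq n (inv \<sigma>) y) * ennreal (q (perm_seq n (inv \<sigma>) y) \<sigma>) =
        ennreal (f y / c y * indicator E (perm_seq n (inv \<sigma>) y))" if \<sigma>: "\<sigma> \<in> perms n" for \<sigma>
    proof -
      have "F y * q (perm_seq n (inv \<sigma>) y) \<sigma> = f y"
        using f_le_F f(3)[of y] \<sigma> y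
        by (auto simp: q_def F_inv inv_in_perms perm_seq_inv_cancel)
      then have "F y / c y * indicator E (perm_seq n (inv \<sigma>) y) * q (perm_seq n (inv \<sigma>) y) \<sigma> =
          f y / c y * indicator E (perm_seq n (inv \<sigma>) y)"
        by (simp split: split_indicator)
      then show ?thesis
        using \<sigma> q_nonneg F_nonneg c_nonneg
        by (simp only: g_def F_inv c_inv inv_in_perms flip: ennreal_mult'')
    qed
    have "(\<Sum>\<sigma>\<in>perms n. g (perm_seq n (inv \<sigma>) y) * ennreal (q (perm_seq n (inv \<sigma>) y) \<sigma>)) =
        ennreal (\<Sum>\<sigma>\<in>perms n. f y / c y * indicator E (perm_seq n (inv \<sigma>) y))"
      using f(3) c_nonneg by (subst sum_ennreal[symmetric]) (auto simp: summand)
    also have "(\<Sum>\<sigma>\<in>perms n. f y / c y * indicator E (perm_seq n (inv \<sigma>) y)) = f y / c y * c y"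
      unfolding c_def using sum_perms_inv[of "\<lambda>\<sigma>. indicator E (perm_seq n \<sigma> y) :: real" n]
      by (simp only: flip: sum_distrib_left)
    finally show ?thesis using c_pos[OF y] by simp
  qed

  show thesis
  proof (rule that[of g q])
    fix A assume A: "A \<in> sets (seq_space n S)"
    have [measurable]: "(\<lambda>x. indicator A (perm_seq n \<sigma> x) :: ennreal) \<in> borel_measurable (seq_space n S)"
      if "\<sigma> \<in> perms n" for \<sigma>
      by (rule measurable_compose[OF measurable_perm_seq[OF that] borel_measurable_indicator[OF A]])
    note [measurable] = g_meas q_meas
    define h where "h \<sigma> y = g (perm_seq n (inv \<sigma>) y) * ennreal (q (perm_seq n (inv \<sigma>) y) \<sigma>) * indicator A y"
      for \<sigma> y
    have h_meas: "h \<sigma> \<in> borel_measurable (seq_space n S)" if \<sigma>: "\<sigma> \<in> perms n" for \<sigma>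
    proof -
      have "(\<lambda>y. g (perm_seq n (inv \<sigma>) y)) \<in> borel_measurable (seq_space n S)"
        "(\<lambda>y. q (perm_seq n (inv \<sigma>) y) \<sigma>) \<in> borel_measurable (seq_space n S)"
        using measurable_compose[OF measurable_perm_seq[OF inv_in_perms[OF \<sigma>]]] g_meas q_meas[OF \<sigma>] by blast+
      then show ?thesis
        unfolding h_def using A by measurable
    qed
    have "(\<integral>\<^sup>+x. (\<Sum>\<sigma>\<in>perms n. ennreal (q x \<sigma>) * indicator A (perm_seq n \<sigma> x)) \<partial>density L g) =
        (\<integral>\<^sup>+x. g x * (\<Sum>\<sigma>\<in>perms n. ennreal (q x \<sigma>) * indicator A (perm_seq n \<sigma> x)) \<partial>L)"
      by (rule nn_integral_density) simp_all
    also have "\<dots> = (\<integral>\<^sup>+x. (\<Sum>\<sigma>\<in>perms n. g x * ennreal (q x \<sigma>) * indicator A (perm_seq n \<sigma> x)) \<partial>L)"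
      by (simp add: sum_distrib_left mult.assoc)
    also have "\<dots> = (\<Sum>\<sigma>\<in>perms n. \<integral>\<^sup>+x. g x * ennreal (q x \<sigma>) * indicator A (perm_seq n \<sigma> x) \<partial>L)"
      by (rule nn_integral_sum) simp
    also have "\<dots> = (\<Sum>\<sigma>\<in>perms n. \<integral>\<^sup>+y. h \<sigma> y \<partial>L)"
    proof (rule sum.cong[OF refl])
      fix \<sigma> assume \<sigma>: "\<sigma> \<in> perms n"
      \<comment> \<open>The substitution \<open>y = \<sigma>(x)\<close>, under which \<open>L\<close> is invariant.\<close>
      have "(\<integral>\<^sup>+x. g x * ennreal (q x \<sigma>) * indicator A (perm_seq n \<sigma> x) \<partial>L) =
          (\<integral>\<^sup>+x. h \<sigma> (perm_seq n \<sigma> x) \<partial>L)"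
        using \<sigma> by (intro nn_integral_cong) (simp add: h_def perm_seq_inv_cancel)
      also have "\<dots> = (\<integral>\<^sup>+y. h \<sigma> y \<partial>L)"
        unfolding L_def by (rule nn_integral_symmetrization_perm_seq[OF sf \<nu>(2) h_meas[OF \<sigma>] \<sigma>])
      finally show "(\<integral>\<^sup>+x. g x * ennreal (q x \<sigma>) * indicator A (perm_seq n \<sigma> x) \<partial>L) = (\<integral>\<^sup>+y. h \<sigma> y \<partial>L)" .
    qed
    also have "\<dots> = (\<integral>\<^sup>+y. (\<Sum>\<sigma>\<in>perms n. h \<sigma> y) \<partial>L)"
      using h_meas by (intro nn_integral_sum[symmetric]) simp
    also have "\<dots> = (\<integral>\<^sup>+y. ennreal (f y) * indicator A y \<partial>L)"
      by (intro nn_integral_cong) (simp add: h_def balance flip: sum_distrib_right)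
    also have "\<dots> = emeasure \<nu> A"
      using A by (subst \<nu>_density, subst emeasure_density) auto
    finally show "emeasure \<nu> A = (\<integral>\<^sup>+x. (\<Sum>\<sigma>\<in>perms n. ennreal (q x \<sigma>) * indicator A (perm_seq n \<sigma> x))
        \<partial>density (symmetrization n S \<nu>) g)"
      by (simp add: L_def)
  qed (use g_meas q_meas q_nonneg q_sum in \<open>auto simp: g_def\<close>)
qed

section \<open>Mixtures of elementary sequences\<close>

text \<open>The envelope is taken with respect to the symmetrization, not \<open>\<nu>\<close>: the mixing measure has
  a density with respect to the former, and \<open>\<nu>\<close> may give no mass to ordered sequences at all.\<close>
lemma mixture_over_ordered_subdomain:
  fixes \<nu> :: "(nat \<Rightarrow> 'a) measure"
  assumes \<nu>: "prob_space \<nu>" "sets \<nu> = sets (seq_space n S)" and r: "linear_order_on (space S) r"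
  obtains \<mu> :: "(nat \<Rightarrow> 'a) measure"
      and P :: "((nat \<Rightarrow> nat) \<times> ((nat \<Rightarrow> 'a) \<Rightarrow> nat \<Rightarrow> nat)) measure" and \<alpha> \<beta>
  where "prob_space \<mu>" "sets \<mu> = sets (seq_space n S)" "order_respecting n S r \<mu>"
    "random_perm_family P n S \<alpha> \<beta>"
    "\<And>A. A \<in> sets (seq_space n S) \<Longrightarrow>
      integrable \<mu> (\<lambda>x. \<P>(\<omega> in P. comp_perm_seq n (\<alpha> \<omega>) (\<beta> x \<omega>) x \<in> A))"
    "\<And>A. A \<in> sets (seq_space n S) \<Longrightarrow>
      (\<integral>x. \<P>(\<omega> in P. comp_perm_seq n (\<alpha> \<omega>) (\<beta> x \<omega>) x \<in> A) \<partial>\<mu>) = measure \<nu> A"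
proof -
  interpret \<nu>: prob_space \<nu> by fact
  let ?L = "symmetrization n S \<nu>" and ?\<Omega> = "ordered_subdomain n S r"
  have "finite_measure ?L"
    using \<nu>.finite_measure_axioms \<nu>(2) by (rule finite_measure_symmetrization)
  moreover have "?\<Omega> \<subseteq> space ?L"
    by (auto simp: ordered_subdomain_def)
  ultimately obtain E where env: "measurable_envelope ?L ?\<Omega> E"
    using ex_measurable_envelope by blast
  note E = measurable_envelopeD(1,2)[OF env]
  have "\<exists>\<sigma>\<in>perms n. perm_seq n \<sigma> x \<in> E" if "x \<in> space (seq_space n S)" for x
    using ex_perm_ordered[OF r that] E(1) by blast
  then obtain g :: "(nat \<Rightarrow> 'a) \<Rightarrow> ennreal" and q :: "(nat \<Rightarrow> 'a) \<Rightarrow> (nat \<Rightarrow> nat) \<Rightarrow> real"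
    where g: "g \<in> borel_measurable (seq_space n S)" "\<And>x. x \<notin> E \<Longrightarrow> g x = 0"
      and q: "\<And>\<sigma>. \<sigma> \<in> perms n \<Longrightarrow> (\<lambda>x. q x \<sigma>) \<in> borel_measurable (seq_space n S)"
        "\<And>x \<sigma>. 0 \<le> q x \<sigma>" "\<And>x. (\<Sum>\<sigma>\<in>perms n. q x \<sigma>) = 1"
      and rep: "\<And>A. A \<in> sets (seq_space n S) \<Longrightarrow> emeasure \<nu> A =
        (\<integral>\<^sup>+x. (\<Sum>\<sigma>\<in>perms n. ennreal (q x \<sigma>) * indicator A (perm_seq n \<sigma> x)) \<partial>density ?L g)"
    using disintegration_over_transversal[OF \<nu>.finite_measure_axioms \<nu>(2), of E] E(2) by auto
  define \<mu> where "\<mu> = density ?L g"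
  have sets_\<mu>: "sets \<mu> = sets (seq_space n S)" and space_\<mu>: "space \<mu> = space (seq_space n S)"
    by (simp_all add: \<mu>_def)
  have "space (seq_space n S) \<noteq> {}"
    using \<nu>.not_empty sets_eq_imp_space_eq[OF \<nu>(2)] by simp
  then interpret K: perm_kernel n S q
    using q by unfold_locales auto
  have sum_one: "(\<Sum>\<sigma>\<in>perms n. ennreal (q x \<sigma>)) = 1" if "x \<in> space \<mu>" for x
    using K.ennreal_sum_kernel that space_\<mu> by simp
  \<comment> \<open>The representation for the whole space shows that \<open>\<mu>\<close> has the same total mass as \<open>\<nu>\<close>.\<close>
  have "prob_space \<mu>"
  proof
    have "emeasure \<mu> (space \<mu>) = (\<integral>\<^sup>+x. (\<Sum>\<sigma>\<in>perms n. ennreal (q x \<sigma>) * indicator (space \<nu>) (perm_seq n \<sigma> x)) \<partial>\<mu>)"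
      using sum_one sets_eq_imp_space_eq[OF \<nu>(2)] space_\<mu>
      by (subst nn_integral_cong[where v="\<lambda>_. 1"]) (auto simp: perm_seq_in_space)
    also have "\<dots> = emeasure \<nu> (space \<nu>)"
      using rep[of "space \<nu>"] \<nu>(2) sets.top[of \<nu>] by (simp add: \<mu>_def)
    finally show "emeasure \<mu> (space \<mu>) = 1" by (simp add: \<nu>.emeasure_space_1)
  qed
  interpret \<mu>: prob_space \<mu> by fact
  interpret C: prob_space K.coupling by (rule K.prob_space_coupling)
  let ?pr = "\<lambda>A x. \<P>(\<omega> in K.coupling. comp_perm_seq n (fst \<omega>) (K.second_perm x \<omega>) x \<in> A)"
  have pr: "ennreal (?pr A x) = (\<Sum>\<sigma>\<in>perms n. ennreal (q x \<sigma>) * indicator A (perm_seq n \<sigma> x))"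
    if "x \<in> space \<mu>" for A x
    using K.emeasure_coupling_comp_perm_seq[of x A] that space_\<mu> by (simp add: C.emeasure_eq_measure)
  have pr_real: "?pr A x = (\<Sum>\<sigma>\<in>perms n. q x \<sigma> * indicator A (perm_seq n \<sigma> x))"
    if x: "x \<in> space \<mu>" for A x
  proof -
    have "ennreal (?pr A x) = ennreal (\<Sum>\<sigma>\<in>perms n. q x \<sigma> * indicator A (perm_seq n \<sigma> x))"
      unfolding pr[OF x] using q(2)
      by (subst sum_ennreal[symmetric]) (auto simp: ennreal_mult'' simp flip: ennreal_indicator)
    then show ?thesis
      using q(2) by (subst (asm) ennreal_inj) (auto intro!: sum_nonneg)
  qed
  have meas: "?pr A \<in> borel_measurable \<mu>" if A: "A \<in> sets (seq_space n S)" for A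
  proof -
    have "(\<lambda>x. indicator A (perm_seq n \<sigma> x) :: real) \<in> borel_measurable (seq_space n S)" if "\<sigma> \<in> perms n" for \<sigma>
      by (rule measurable_compose[OF measurable_perm_seq[OF that] borel_measurable_indicator[OF A]])
    then have "(\<lambda>x. \<Sum>\<sigma>\<in>perms n. q x \<sigma> * indicator A (perm_seq n \<sigma> x)) \<in> borel_measurable (seq_space n S)"
      using q(1) by (intro borel_measurable_sum borel_measurable_times)
    then have "(\<lambda>x. \<Sum>\<sigma>\<in>perms n. q x \<sigma> * indicator A (perm_seq n \<sigma> x)) \<in> borel_measurable \<mu>"
      unfolding measurable_cong_sets[OF sets_\<mu> refl] .
    then show ?thesis
      by (subst measurable_cong[OF pr_real]) auto
  qed
  show thesis
  proof (rule that[of \<mu> K.coupling fst K.second_perm])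
    fix A assume A: "A \<in> sets (seq_space n S)"
    show int: "integrable \<mu> (?pr A)"
      using meas[OF A] by (intro \<mu>.integrable_const_bound[where B=1]) auto
    have "(\<integral>\<^sup>+x. ennreal (?pr A x) \<partial>\<mu>) = emeasure \<nu> A"
      unfolding rep[OF A] \<mu>_def[symmetric] by (intro nn_integral_cong pr)
    then show "(\<integral>x. ?pr A x \<partial>\<mu>) = measure \<nu> A"
      using meas[OF A] by (subst integral_eq_nn_integral) (auto simp: measure_def)
  next
    show "order_respecting n S r \<mu>"
      unfolding order_respecting_iff_envelope[OF sets_\<mu>] unfolding \<mu>_def
      using env g by (intro density_restricts_envelope) auto
  qed (use \<open>prob_space \<mu>\<close> sets_\<mu> K.random_perm_family_coupling in auto)
qed

lemma prob_seq_eq_measure_distr: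
  assumes "\<And>i. i \<in> {1..n} \<Longrightarrow> X i \<in> measurable M S" and A: "A \<in> sets (seq_space n S)"
  shows "\<P>(\<omega> in M. (\<lambda>i\<in>{1..n}. X i \<omega>) \<in> A) =
    measure (distr M (seq_space n S) (\<lambda>\<omega>. \<lambda>i\<in>{1..n}. X i \<omega>)) A"
proof -
  have "(\<lambda>\<omega>. \<lambda>i\<in>{1..n}. X i \<omega>) \<in> measurable M (seq_space n S)"
    unfolding seq_space_def using assms(1) by (rule measurable_restrict)
  then show ?thesis
    using A by (simp add: measure_distr vimage_def Int_def conj_commute)
qed

theorem theorem11:
  fixes M :: "'w measure" and S :: "'a measure" and X :: "nat \<Rightarrow> 'w \<Rightarrow> 'a" and n :: nat
  assumes "prob_space M"
    and "\<And>i. i \<in> {1..n} \<Longrightarrow> X i \<in> measurable M S"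
  shows
    "(\<exists>(\<mu> :: (nat \<Rightarrow> 'a) measure)
        (P :: ((nat \<Rightarrow> nat) \<times> ((nat \<Rightarrow> 'a) \<Rightarrow> nat \<Rightarrow> nat)) measure) \<alpha> \<beta>.
        prob_space \<mu> \<and> sets \<mu> = sets (seq_space n S) \<and>
        random_perm_family P n S \<alpha> \<beta> \<and>
        (\<forall>A\<in>sets (seq_space n S).
          integrable \<mu> (\<lambda>x. \<P>(\<omega> in P. comp_perm_seq n (\<alpha> \<omega>) (\<beta> x \<omega>) x \<in> A)) \<and>
          \<P>(\<omega> in M. (\<lambda>i\<in>{1..n}. X i \<omega>) \<in> A) =
            (\<integral>x. \<P>(\<omega> in P. comp_perm_seq n (\<alpha> \<omega>) (\<beta> x \<omega>) x \<in> A) \<partial>\<mu>)))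
     \<and>
     (\<forall>r. linear_order_on (space S) r \<longrightarrow>
      (\<exists>(\<mu> :: (nat \<Rightarrow> 'a) measure)
        (P :: ((nat \<Rightarrow> nat) \<times> ((nat \<Rightarrow> 'a) \<Rightarrow> nat \<Rightarrow> nat)) measure) \<alpha> \<beta>.
        prob_space \<mu> \<and> sets \<mu> = sets (seq_space n S) \<and>
        order_respecting n S r \<mu> \<and>
        random_perm_family P n S \<alpha> \<beta> \<and>
        (\<forall>A\<in>sets (seq_space n S).
          integrable \<mu> (\<lambda>x. \<P>(\<omega> in P. comp_perm_seq n (\<alpha> \<omega>) (\<beta> x \<omega>) x \<in> A)) \<and>
          \<P>(\<omega> in M. (\<lambda>i\<in>{1..n}. X i \<omega>) \<in> A) =
            (\<integral>x. \<P>(\<omega> in P. comp_perm_seq n (\<alpha> \<omega>) (\<beta> x \<omega>) x \<in> A) \<partial>\<mu>) \<and>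
          integrable (trace_measure \<mu> (ordered_subdomain n S r))
            (\<lambda>x. \<P>(\<omega> in P. comp_perm_seq n (\<alpha> \<omega>) (\<beta> x \<omega>) x \<in> A)) \<and>
          \<P>(\<omega> in M. (\<lambda>i\<in>{1..n}. X i \<omega>) \<in> A) =
            (\<integral>x. \<P>(\<omega> in P. comp_perm_seq n (\<alpha> \<omega>) (\<beta> x \<omega>) x \<in> A)
              \<partial>trace_measure \<mu> (ordered_subdomain n S r)))))"
  (is "?unordered \<and> (\<forall>r. linear_order_on (space S) r \<longrightarrow> ?ordered r)")
proof -
  let ?\<nu> = "distr M (seq_space n S) (\<lambda>\<omega>. \<lambda>i\<in>{1..n}. X i \<omega>)"
  have "(\<lambda>\<omega>. \<lambda>i\<in>{1..n}. X i \<omega>) \<in> measurable M (seq_space n S)"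
    unfolding seq_space_def using assms(2) by (rule measurable_restrict)
  then have \<nu>: "prob_space ?\<nu>" "sets ?\<nu> = sets (seq_space n S)"
    using prob_space.prob_space_distr[OF assms(1)] by auto
  have ordered: "?ordered r" if r: "linear_order_on (space S) r" for r
  proof -
    obtain \<mu> :: "(nat \<Rightarrow> 'a) measure"
        and P :: "((nat \<Rightarrow> nat) \<times> ((nat \<Rightarrow> 'a) \<Rightarrow> nat \<Rightarrow> nat)) measure" and \<alpha> \<beta>
      where \<mu>: "prob_space \<mu>" "sets \<mu> = sets (seq_space n S)" "order_respecting n S r \<mu>"
        and P: "random_perm_family P n S \<alpha> \<beta>"
        and int: "\<And>A. A \<in> sets (seq_space n S) \<Longrightarrow>
          integrable \<mu> (\<lambda>x. \<P>(\<omega> in P. comp_perm_seq n (\<alpha> \<omega>) (\<beta> x \<omega>) x \<in> A))"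
        and eq: "\<And>A. A \<in> sets (seq_space n S) \<Longrightarrow>
          (\<integral>x. \<P>(\<omega> in P. comp_perm_seq n (\<alpha> \<omega>) (\<beta> x \<omega>) x \<in> A) \<partial>\<mu>) = measure ?\<nu> A"
      by (rule mixture_over_ordered_subdomain[OF \<nu> r]) (rule that)
    have env: "measurable_envelope \<mu> (ordered_subdomain n S r) (space \<mu>)"
      using \<mu>(3) order_respecting_iff_envelope[OF \<mu>(2)] by simp
    have "integrable (trace_measure \<mu> (ordered_subdomain n S r)) h"
      and "(\<integral>x. h x \<partial>trace_measure \<mu> (ordered_subdomain n S r)) = (\<integral>x. h x \<partial>\<mu>)"
      if "integrable \<mu> h" for h :: "(nat \<Rightarrow> 'a) \<Rightarrow> real"
      using integrable_distr[OF distr_trace_measure(1)[OF env], of h]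
        integral_distr[OF distr_trace_measure(1)[OF env], of h] that
      by (simp_all add: distr_trace_measure(2)[OF env] borel_measurable_integrable)
    then show ?thesis
      using \<mu> P int eq prob_seq_eq_measure_distr[of n X M S] assms(2)
      by (intro exI[of _ \<mu>] exI[of _ P] exI[of _ \<alpha>] exI[of _ \<beta>]) simp
  qed
  moreover have ?unordered
  proof -
    \<comment> \<open>Some linear order always exists, for instance a well-order; forgetting it in the
      ordered representation leaves the unordered one.\<close>
    obtain r where "well_order_on (space S) r"
      using well_order_on by blast
    then have r: "linear_order_on (space S) r"
      by (simp add: well_order_on_def)
    obtain \<mu> :: "(nat \<Rightarrow> 'a) measure"
        and P :: "((nat \<Rightarrow> nat) \<times> ((nat \<Rightarrow> 'a) \<Rightarrow> nat \<Rightarrow> nat)) measure" and \<alpha> \<beta>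
      where "prob_space \<mu>" "sets \<mu> = sets (seq_space n S)" "random_perm_family P n S \<alpha> \<beta>"
        and "\<And>A. A \<in> sets (seq_space n S) \<Longrightarrow>
          integrable \<mu> (\<lambda>x. \<P>(\<omega> in P. comp_perm_seq n (\<alpha> \<omega>) (\<beta> x \<omega>) x \<in> A))"
        and "\<And>A. A \<in> sets (seq_space n S) \<Longrightarrow>
          (\<integral>x. \<P>(\<omega> in P. comp_perm_seq n (\<alpha> \<omega>) (\<beta> x \<omega>) x \<in> A) \<partial>\<mu>) = measure ?\<nu> A"
      by (rule mixture_over_ordered_subdomain[OF \<nu> r]) (rule that)
    then show ?thesis
      using prob_seq_eq_measure_distr[of n X M S] assms(2)
      by (intro exI[of _ \<mu>] exI[of _ P] exI[of _ \<alpha>] exI[of _ \<beta>]) simp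
  qed
  ultimately show ?thesis by blast
qed

end
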